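(* Let $T>0$ and the spatial mesh size $h>0$ be fixed. Let $f:\mathbb{R}\to\mathbb{R}$ and $\beta>0$ be such that $f(\beta)\le0\le f(-\beta)$ and $f$ is continuously differentiable and nonconstant on $[-\beta,\beta]$, and let $\|u_0\|_{L^\infty}\le\beta$. Assume that $\boldsymbol u\in\mathcal C([0,T];\mathbb{R}^N)$, with $\|\boldsymbol u(t)\|_\infty\le\beta$ for all $t\in[0,T]$, is the exact solution of $$\frac{d\boldsymbol u}{dt}=\boldsymbol A\boldsymbol u+\boldsymbol f(\boldsymbol u),\qquad \boldsymbol u(0)=(u_0(x_1),\dots,u_0(x_N))^T,$$ and that $\{\boldsymbol U_m\}_{m=0}^M$ is the numerical solution generated by the LRI1b scheme $$\boldsymbol U_0=\boldsymbol u(0),\qquad \boldsymbol U_{m+1}=e^{\Delta t\boldsymbol A}\boldsymbol U_m+\Delta t\,\boldsymbol f\bigl(e^{\Delta t\boldsymbol A}\boldsymbol U_m\bigr),\quad m=0,\dots,M-1.$$ Then there exists a constant $C=C(\beta,F_0,F_1,\|\boldsymbol A\|_\infty)>0$, independent of $\Delta t$, such that for all $0<\Delta t\le\omega_0$, $$\|\boldsymbol U_m-\boldsymbol u(t_m)\|_\infty\le C\,(e^{F_1t_m}-1)\,\Delta t,\qquad m=0,1,\dots,M.$$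
   Context: Setting (space discretization by central finite differences, homogeneous Neumann boundary conditions, of $\partial_t u=\varepsilon^2\Delta u+f(u)$ on $\Omega$ with initial datum $u_0:\overline\Omega\to\mathbb{R}$): $d\in\{1,2,3\}$, $\Omega\subset\mathbb{R}^d$ is an open bounded interval ($d=1$), rectangle ($d=2$) or rectangular parallelepiped ($d=3$), $\varepsilon>0$. A uniform grid with mesh size $h>0$ in every direction is used, with $n_k\ge2$ grid points (boundary points included) in direction $k$, $N=n_1\cdots n_d$, and grid points $x_1,\dots,x_N\in\overline\Omega$ (first coordinate varying fastest). For $n\ge 2$ let $\boldsymbol\lambda_h^{(n)}$ be $\frac1{h^2}$ times the $n\times n$ tridiagonal matrix with all diagonal entries $-2$, first row $(-2,2,0,\dots,0)$, last row $(0,\dots,0,2,-2)$, and every interior row having entries $1,-2,1$ in the sub-, main and superdiagonal positions. Set $\boldsymbol D_h=\boldsymbol\lambda_h^{(n_1)}$ if $d=1$; $\boldsymbol D_h=\boldsymbol I\otimes\boldsymbol\lambda_h^{(n_1)}+\boldsymbol\lambda_h^{(n_2)}\otimes\boldsymbol I$ if $d=2$; $\boldsymbol D_h=\boldsymbol I\otimes\boldsymbol I\otimes\boldsymbol\lambda_h^{(n_1)}+\boldsymbol I\otimes\boldsymbol\lambda_h^{(n_2)}\otimes\boldsymbol I+\boldsymbol\lambda_h^{(n_3)}\otimes\boldsymbol I\otimes\boldsymbol I$ if $d=3$ ($\otimes$ is the Kronecker product, $\boldsymbol I$ identity matrices of the appropriate sizes), and $\boldsymbol A=\varepsilon^2\boldsymbol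 D_h\in\mathbb{R}^{N\times N}$. Time grid: $M$ is a positive integer, $\Delta t=T/M$, $t_m=m\Delta t$. Constants: $\omega_0=-1/\min_{|x|\le\beta}f'(x)>0$ (the minimum is negative), $F_0=\max_{|x|\le\beta}|f(x)|$, $F_1=\max_{|x|\le\beta}|f'(x)|$. Notation: $\boldsymbol f(\boldsymbol v)=(f(v_1),\dots,f(v_N))^T$ for $\boldsymbol v\in\mathbb{R}^N$; $\|\cdot\|_\infty$ is the maximum norm on $\mathbb{R}^N$ and the induced matrix norm; $\|u_0\|_{L^\infty}=\max_{x\in\overline\Omega}|u_0(x)|$. *)

theory Defs
  imports
    Complex_Main
    "HOL-Library.Extended_Real"
    "Jordan_Normal_Form.Matrix"
begin

(* Vectors and matrices carry their size as a value, so that the number of grid points can be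
   quantified inside a formula.  All indices start at 0. *)

definition linf_vec :: "real vec \<Rightarrow> real" where
  "linf_vec v = Max ((\<lambda>i. \<bar>v $ i\<bar>) ` {..<dim_vec v})"

definition linf_mat :: "real mat \<Rightarrow> real" where
  "linf_mat A =
    (SUP v\<in>{v \<in> carrier_vec (dim_col A). linf_vec v = 1}. linf_vec (A *\<^sub>v v))"

(* entrywise power series; intended for square A, where it converges *)
definition exp_mat :: "real mat \<Rightarrow> real mat" where
  "exp_mat A = mat (dim_row A) (dim_col A) (\<lambda>(i, j). \<Sum>k. (A ^\<^sub>m k) $$ (i, j) / fact k)"

definition kron :: "real mat \<Rightarrow> real mat \<Rightarrow> real mat" (infixr \<open>\<otimes>\<^sub>K\<close> 71) where
  "A \<otimes>\<^sub>K B = mat (dim_row A * dim_row B) (dim_col A * dim_col B)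
     (\<lambda>(i, j). A $$ (i div dim_row B, j div dim_col B) * B $$ (i mod dim_row B, j mod dim_col B))"

definition lambda_h :: "real \<Rightarrow> nat \<Rightarrow> real mat" where
  "lambda_h h n = (1 / h\<^sup>2) \<cdot>\<^sub>m mat n n (\<lambda>(i, j).
     if i = j then - 2
     else if i = 0 then (if j = 1 then 2 else 0)
     else if i = n - 1 then (if j = n - 2 then 2 else 0)
     else if j = i - 1 \<or> j = i + 1 then 1
     else 0)"

(* only used with one, two or three directions *)
fun D_h :: "real \<Rightarrow> nat list \<Rightarrow> real mat" where
  "D_h h [n1] = lambda_h h n1"
| "D_h h [n1, n2] = 1\<^sub>m n2 \<otimes>\<^sub>K lambda_h h n1 + lambda_h h n2 \<otimes>\<^sub>K 1\<^sub>m n1"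
| "D_h h [n1, n2, n3] =
     1\<^sub>m n3 \<otimes>\<^sub>K 1\<^sub>m n2 \<otimes>\<^sub>K lambda_h h n1
     + 1\<^sub>m n3 \<otimes>\<^sub>K lambda_h h n2 \<otimes>\<^sub>K 1\<^sub>m n1
     + lambda_h h n3 \<otimes>\<^sub>K 1\<^sub>m n2 \<otimes>\<^sub>K 1\<^sub>m n1"
| "D_h h _ = 0\<^sub>m 0 0"

(* The domain is the open box with opposite corners a and b; ns lists the numbers of grid points
   per direction, boundary points included. *)
definition uniform_grid :: "real \<Rightarrow> real vec \<Rightarrow> real vec \<Rightarrow> nat list \<Rightarrow> bool" where
  "uniform_grid h a b ns \<longleftrightarrow>
     0 < h \<and> length ns \<in> {1, 2, 3} \<and>
     a \<in> carrier_vec (length ns) \<and> b \<in> carrier_vec (length ns) \<and>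
     (\<forall>k < length ns. 2 \<le> ns ! k \<and> b $ k - a $ k = (real (ns ! k) - 1) * h)"

(* the closure of the open box, which is nondegenerate under uniform_grid *)
definition closed_box :: "real vec \<Rightarrow> real vec \<Rightarrow> real vec set" where
  "closed_box a b =
     {x \<in> carrier_vec (dim_vec a). \<forall>k < dim_vec a. a $ k \<le> x $ k \<and> x $ k \<le> b $ k}"

(* mixed-radix digits of i, so that the first coordinate varies fastest *)
definition grid_point :: "real \<Rightarrow> real vec \<Rightarrow> nat list \<Rightarrow> nat \<Rightarrow> real vec" where
  "grid_point h a ns i =
     vec (length ns) (\<lambda>k. a $ k + real (i div prod_list (take k ns) mod (ns ! k)) * h)"

definition grid_restriction ::
    "real \<Rightarrow> real vec \<Rightarrow> nat list \<Rightarrow> (real vec \<Rightarrow> real) \<Rightarrow> real vec" where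
  "grid_restriction h a ns u0 = vec (prod_list ns) (\<lambda>i. u0 (grid_point h a ns i))"

(* extended-real valued, so that an unbounded function has norm infinity *)
definition Linf_norm :: "real vec set \<Rightarrow> (real vec \<Rightarrow> real) \<Rightarrow> ereal" where
  "Linf_norm S g = (SUP x\<in>S. ereal \<bar>g x\<bar>)"

(* f' is the derivative of f on the closed interval, one-sided at the end points *)
definition C1_on_interval :: "real \<Rightarrow> (real \<Rightarrow> real) \<Rightarrow> (real \<Rightarrow> real) \<Rightarrow> bool" where
  "C1_on_interval \<beta> f f' \<longleftrightarrow>
     (\<forall>x\<in>{-\<beta>..\<beta>}. (f has_real_derivative f' x) (at x within {-\<beta>..\<beta>})) \<and>
     continuous_on {-\<beta>..\<beta>} f'"

(* The extrema below are attained: f and f' are continuous on a compact interval. *)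

definition omega0 :: "real \<Rightarrow> (real \<Rightarrow> real) \<Rightarrow> real" where
  "omega0 \<beta> f' = - 1 / (INF x\<in>{-\<beta>..\<beta>}. f' x)"

definition max_abs :: "real \<Rightarrow> (real \<Rightarrow> real) \<Rightarrow> real" where
  "max_abs \<beta> g = (SUP x\<in>{-\<beta>..\<beta>}. \<bar>g x\<bar>)"

(* Continuity and differentiability of the vector-valued u are componentwise; map_vec f is f
   acting componentwise. *)
definition solves_ode ::
    "real mat \<Rightarrow> (real \<Rightarrow> real) \<Rightarrow> real vec \<Rightarrow> real \<Rightarrow> (real \<Rightarrow> real vec) \<Rightarrow> bool" where
  "solves_ode A f v0 T u \<longleftrightarrow>
     (\<forall>t\<in>{0..T}. u t \<in> carrier_vec (dim_vec v0)) \<and>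
     (\<forall>i < dim_vec v0. continuous_on {0..T} (\<lambda>t. u t $ i)) \<and>
     (\<forall>t\<in>{0<..T}. \<forall>i < dim_vec v0.
        ((\<lambda>s. u s $ i) has_real_derivative (A *\<^sub>v u t + map_vec f (u t)) $ i)
          (at t within {0..T})) \<and>
     u 0 = v0"

primrec LRI1b :: "real mat \<Rightarrow> (real \<Rightarrow> real) \<Rightarrow> real \<Rightarrow> real vec \<Rightarrow> nat \<Rightarrow> real vec" where
  "LRI1b A f \<tau> v0 0 = v0"
| "LRI1b A f \<tau> v0 (Suc m) =
     (let w = exp_mat (\<tau> \<cdot>\<^sub>m A) *\<^sub>v LRI1b A f \<tau> v0 m
      in w + \<tau> \<cdot>\<^sub>v map_vec f w)"

end

theory Submission
  imports Defs
begin

text \<open>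
  The matrix \<open>A\<close> has nonnegative off-diagonal entries and zero row sums, so \<open>exp (s A)\<close> is a
  contraction in the maximum norm for \<open>s \<ge> 0\<close>.  For \<open>0 < \<tau> \<le> omega0\<close> the map \<open>x + \<tau> f x\<close> is
  monotone on \<open>[-\<beta>, \<beta>]\<close> and leaves this interval invariant, so the numerical solution stays in
  the region where \<open>f\<close> has Lipschitz constant \<open>F1\<close>.  The local error is bounded by
  \<open>K \<tau>\<^sup>2\<close> with \<open>K = \<parallel>A\<parallel> F0 + F1 (2 \<parallel>A\<parallel> \<beta> + F0)\<close>, and a
  discrete Gronwall argument gives the constant \<open>K / F1\<close>.  Here \<open>F1 > 0\<close> because \<open>f\<close> is
  not constant.
\<close>

section \<open>The maximum norm and its induced matrix norm\<close>

lemma linf_vec_le_iff: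
  assumes "v \<in> carrier_vec n" "0 < n"
  shows "linf_vec v \<le> b \<longleftrightarrow> (\<forall>i<n. \<bar>v $ i\<bar> \<le> b)"
proof -
  have "(\<lambda>i. \<bar>v $ i\<bar>) ` {..<n} \<noteq> {}" using assms(2) by auto
  then show ?thesis
    using assms(1) by (auto simp: linf_vec_def)
qed

lemma mult_mat_vec_index_sum:
  assumes "A \<in> carrier_mat n m" "v \<in> carrier_vec m" "i < n"
  shows "(A *\<^sub>v v) $ i = (\<Sum>j<m. A $$ (i, j) * v $ j)"
  using assms by (auto simp: scalar_prod_def atLeast0LessThan intro!: sum.cong)

lemma mult_mat_index_sum:
  assumes "A \<in> carrier_mat n m" "B \<in> carrier_mat m p" "i < n" "j < p"
  shows "(A * B) $$ (i, j) = (\<Sum>k<m. A $$ (i, k) * B $$ (k, j))"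
  using assms by (auto simp: scalar_prod_def atLeast0LessThan intro!: sum.cong)

lemma linf_vec_nonneg:
  assumes "v \<in> carrier_vec n" "0 < n"
  shows "0 \<le> linf_vec v"
  using linf_vec_le_iff[OF assms, of "linf_vec v"] assms(2) abs_ge_zero order_trans by blast

lemma linf_vec_smult:
  assumes v: "v \<in> carrier_vec n" and n: "0 < n"
  shows "linf_vec (c \<cdot>\<^sub>v v) = \<bar>c\<bar> * linf_vec v"
proof -
  have "(\<lambda>i. \<bar>(c \<cdot>\<^sub>v v) $ i\<bar>) ` {..<n} = (\<lambda>x. \<bar>c\<bar> * x) ` (\<lambda>i. \<bar>v $ i\<bar>) ` {..<n}"
    using v by (auto simp: image_image abs_mult intro!: image_cong)
  moreover have "mono (\<lambda>x. \<bar>c\<bar> * x)"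
    by (simp add: mono_def mult_left_mono)
  ultimately show ?thesis
    using v n mono_Max_commute[of "\<lambda>x. \<bar>c\<bar> * x" "(\<lambda>i. \<bar>v $ i\<bar>) ` {..<n}"]
    by (simp add: linf_vec_def lessThan_empty_iff)
qed

text \<open>A real supremum bounds its members only once the set is known to be bounded above. With
  that settled, a vector of nonzero norm is scaled to norm 1; a vector of norm 0 cannot be scaled
  and is treated apart.\<close>

lemma linf_mat_bound:
  assumes A: "A \<in> carrier_mat n n" and v: "v \<in> carrier_vec n" and n: "0 < n"
  shows "linf_vec (A *\<^sub>v v) \<le> linf_mat A * linf_vec v"
proof -
  \<comment> \<open>The sum of all absolute entries is a crude bound; it serves only to make
    \<open>cSUP_upper\<close> applicable.\<close>
  let ?c = "\<Sum>i<n. \<Sum>j<n. \<bar>A $$ (i, j)\<bar>"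
  have unit: "linf_vec (A *\<^sub>v w) \<le> linf_mat A"
    if w: "w \<in> carrier_vec n" "linf_vec w = 1" for w
  proof -
    have "linf_vec (A *\<^sub>v x) \<le> ?c" if x: "x \<in> carrier_vec n" "linf_vec x = 1" for x
    proof -
      have x1: "\<bar>x $ j\<bar> \<le> 1" if "j < n" for j
        using linf_vec_le_iff[OF x(1) n, of 1] x(2) that by simp
      have "\<bar>(A *\<^sub>v x) $ i\<bar> \<le> ?c" if i: "i < n" for i
      proof -
        have "\<bar>(A *\<^sub>v x) $ i\<bar> \<le> (\<Sum>j<n. \<bar>A $$ (i, j)\<bar> * \<bar>x $ j\<bar>)"
          unfolding mult_mat_vec_index_sum[OF A x(1) i] abs_mult[symmetric] by (rule sum_abs)
        also have "\<dots> \<le> (\<Sum>j<n. \<bar>A $$ (i, j)\<bar>)"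
          using x1 by (intro sum_mono mult_left_le) auto
        also have "\<dots> \<le> ?c"
          using i by (intro member_le_sum[of i "{..<n}" "\<lambda>i. \<Sum>j<n. \<bar>A $$ (i, j)\<bar>"])
            (auto intro: sum_nonneg)
        finally show ?thesis .
      qed
      then show ?thesis
        using linf_vec_le_iff[OF mult_mat_vec_carrier[OF A x(1)] n] by blast
    qed
    then have "bdd_above ((\<lambda>v. linf_vec (A *\<^sub>v v)) `
        {v \<in> carrier_vec (dim_col A). linf_vec v = 1})"
      using A by (intro bdd_aboveI2[of _ _ ?c]) auto
    then show ?thesis
      unfolding linf_mat_def using w A by (intro cSUP_upper) auto
  qed
  show ?thesis
  proof (cases "linf_vec v = 0")
    case True
    then have "v $ j = 0" if "j < n" for j
      using linf_vec_le_iff[OF v n, of 0] that by simp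
    then have "linf_vec (A *\<^sub>v v) \<le> 0"
      using linf_vec_le_iff[of "A *\<^sub>v v" n 0] A v n
      by (auto simp: mult_mat_vec_index_sum[OF A v] simp del: index_mult_mat_vec)
    then show ?thesis using True by simp
  next
    case False
    then have pos: "0 < linf_vec v"
      using linf_vec_nonneg[OF v n] by simp
    let ?w = "(1 / linf_vec v) \<cdot>\<^sub>v v"
    have "linf_vec (A *\<^sub>v ?w) \<le> linf_mat A"
      using v pos by (intro unit) (simp_all add: linf_vec_smult[OF v n])
    moreover have "linf_vec (A *\<^sub>v ?w) = 1 / linf_vec v * linf_vec (A *\<^sub>v v)"
      using linf_vec_smult[of "A *\<^sub>v v" n "1 / linf_vec v"] A v n pos
      by (simp add: mult_mat_vec)
    ultimately show ?thesis
      using pos by (simp add: field_simps)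
  qed
qed

lemma linf_mat_nonneg:
  assumes A: "A \<in> carrier_mat n n" and n: "0 < n"
  shows "0 \<le> linf_mat A"
proof -
  let ?v = "vec n (\<lambda>_. 1 :: real)"
  have v: "?v \<in> carrier_vec n" by simp
  have "linf_vec ?v = 1"
    using n by (simp add: linf_vec_def lessThan_empty_iff cong: image_cong_simp)
  moreover have "0 \<le> linf_vec (A *\<^sub>v ?v)"
    using A n by (intro linf_vec_nonneg[of _ n]) auto
  ultimately show ?thesis
    using linf_mat_bound[OF A v n] by simp
qed

section \<open>Generator matrices and the discrete Laplacian\<close>

text \<open>These are the generators (Q-matrices) of finite continuous-time Markov chains, whose
  exponentials are stochastic at nonnegative times. The class is closed under sums, nonnegative
  scaling and Kronecker products with identities, the operations from which \<open>D_h\<close> is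
  built.\<close>

definition generator_mat :: "nat \<Rightarrow> real mat \<Rightarrow> bool" where
  "generator_mat n A \<longleftrightarrow> A \<in> carrier_mat n n \<and>
     (\<forall>i<n. \<forall>j<n. i \<noteq> j \<longrightarrow> 0 \<le> A $$ (i, j)) \<and> (\<forall>i<n. (\<Sum>j<n. A $$ (i, j)) = 0)"

lemma generator_mat_smult:
  assumes "generator_mat n A" "0 \<le> c"
  shows "generator_mat n (c \<cdot>\<^sub>m A)"
  using assms by (auto simp: generator_mat_def sum_distrib_left[symmetric])

lemma generator_mat_add:
  assumes "generator_mat n A" "generator_mat n B"
  shows "generator_mat n (A + B)"
  using assms by (auto simp: generator_mat_def sum.distrib)

lemma generator_mat_lambda_h:
  assumes "2 \<le> n"
  shows "generator_mat n (lambda_h h n)"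
proof -
  let ?B = "mat n n (\<lambda>(i, j).
     if i = j then - 2
     else if i = 0 then (if j = 1 then 2 else 0)
     else if i = n - 1 then (if j = n - 2 then 2 else 0)
     else if j = i - 1 \<or> j = i + 1 then 1
     else 0) :: real mat"
  have "(\<Sum>j<n. ?B $$ (i, j)) = 0" if i: "i < n" for i
  proof -
    \<comment> \<open>\<open>p\<close> and \<open>q\<close> are the two neighbours of
      \<open>i\<close> after reflection at the boundary. In the first and last row they coincide,
      which accounts for the entry 2 there.\<close>
    define p q where "p = (if i = 0 then 1 else i - 1)" and
      "q = (if i = n - 1 then n - 2 else i + 1)"
    have pq: "p < n" "q < n" using assms i by (auto simp: p_def q_def)
    have "?B $$ (i, j) = (if j = i then -2 else 0) + (if j = p then 1 else 0)
        + (if j = q then 1 else 0)" if "j < n" for j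
    proof -
      consider "i = 0" | "i \<noteq> 0" "i = n - 1" | "i \<noteq> 0" "i \<noteq> n - 1" by blast
      then show ?thesis
      proof cases
        case 1
        then show ?thesis using that i assms by (simp add: p_def q_def)
      next
        case 2
        have "p = n - 2" "q = n - 2" "p \<noteq> i" using 2 i assms by (auto simp: p_def q_def)
        then show ?thesis using 2 that i by simp
      next
        case 3
        have "p = i - 1" "q = i + 1" "p \<noteq> q" "p \<noteq> i" "q \<noteq> i"
          using 3 by (auto simp: p_def q_def)
        then show ?thesis using 3 that i by auto
      qed
    qed
    then have "(\<Sum>j<n. ?B $$ (i, j)) = (\<Sum>j<n. (if j = i then -2 else 0)
        + (if j = p then 1 else 0) + (if j = q then 1 else 0))"
      by (intro sum.cong) auto
    also have "\<dots> = 0"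
      using i pq by (simp add: sum.distrib)
    finally show ?thesis .
  qed
  then have "generator_mat n ?B" by (auto simp: generator_mat_def)
  then show ?thesis
    unfolding lambda_h_def by (rule generator_mat_smult) simp
qed

text \<open>Quotient and remainder identify an index with a pair; each induction step on
  \<open>m\<close> adds one block of \<open>n\<close> consecutive indices. Row sums of Kronecker
  products are computed this way.\<close>

lemma sum_div_mod:
  fixes g :: "nat \<Rightarrow> nat \<Rightarrow> real"
  shows "(\<Sum>j<m * n. g (j div n) (j mod n)) = (\<Sum>p<m. \<Sum>q<n. g p q)"
proof (cases "n = 0")
  case False
  then show ?thesis
  proof (induction m)
    case (Suc m)
    have div_mod: "j div n = m \<and> j mod n = j - m * n" if "m * n \<le> j" "j < m * n + n" for j
    proof -
      have "j div n = m" using that by (intro div_nat_eqI) (auto simp: mult.commute)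
      then show ?thesis by (simp add: minus_div_mult_eq_mod[symmetric])
    qed
    have "(\<Sum>j<Suc m * n. g (j div n) (j mod n))
        = (\<Sum>j<m * n. g (j div n) (j mod n)) + (\<Sum>j\<in>{m * n..<m * n + n}. g (j div n) (j mod n))"
      by (subst sum.union_disjoint[symmetric]) (auto intro!: sum.cong)
    also have "(\<Sum>j\<in>{m * n..<m * n + n}. g (j div n) (j mod n)) = (\<Sum>q<n. g m q)"
      by (rule sum.reindex_bij_witness[of _ "\<lambda>q. m * n + q" "\<lambda>j. j - m * n"])
        (use Suc.prems in \<open>auto simp: div_mod\<close>)
    finally show ?case using Suc by simp
  qed simp
qed simp

lemma kron_carrier:
  assumes "A \<in> carrier_mat m m" "B \<in> carrier_mat n n"
  shows "A \<otimes>\<^sub>K B \<in> carrier_mat (m * n) (m * n)"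
  using assms by (simp add: kron_def)

lemma kron_index:
  assumes "A \<in> carrier_mat m m" "B \<in> carrier_mat n n" "i < m * n" "j < m * n"
  shows "(A \<otimes>\<^sub>K B) $$ (i, j) = A $$ (i div n, j div n) * B $$ (i mod n, j mod n)"
  using assms by (simp add: kron_def)

text \<open>Each entry factorizes over quotient and remainder of the column index, hence so does the
  sum. A zero row sum of one factor therefore survives the product.\<close>

lemma kron_row_sum:
  assumes A: "A \<in> carrier_mat m m" and B: "B \<in> carrier_mat n n" and i: "i < m * n"
  shows "(\<Sum>j<m * n. (A \<otimes>\<^sub>K B) $$ (i, j)) =
    (\<Sum>p<m. A $$ (i div n, p)) * (\<Sum>q<n. B $$ (i mod n, q))"
  using sum_div_mod[of "\<lambda>p q. A $$ (i div n, p) * B $$ (i mod n, q)" n m]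
  by (simp add: kron_index[OF A B i] sum_product)

lemma div_mod_less:
  fixes i :: nat
  assumes "i < m * n"
  shows "i div n < m" "i mod n < n"
proof -
  have "0 < n" using assms by (auto intro: gr0I)
  then show "i div n < m" "i mod n < n" using assms by (auto simp: less_mult_imp_div_less)
qed

lemma div_mod_cancel: "i div n = j div n \<Longrightarrow> i mod n = j mod n \<Longrightarrow> i = j" for i j n :: nat
  by (metis div_mult_mod_eq)

text \<open>Two distinct indices lie either in different blocks, where the identity contributes 0,
  or in the same block at different positions, where an off-diagonal entry of \<open>A\<close>
  appears.\<close>

lemma generator_mat_kron_one_left:
  assumes "generator_mat n A"
  shows "generator_mat (m * n) (1\<^sub>m m \<otimes>\<^sub>K A)"
proof -
  have A: "A \<in> carrier_mat n n" using assms by (simp add: generator_mat_def)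
  show ?thesis
    unfolding generator_mat_def
  proof (intro conjI allI impI)
    show "1\<^sub>m m \<otimes>\<^sub>K A \<in> carrier_mat (m * n) (m * n)"
      by (rule kron_carrier[OF one_carrier_mat A])
  next
    fix i j assume ij: "i < m * n" "j < m * n" "i \<noteq> j"
    have "i mod n \<noteq> j mod n" if "i div n = j div n"
      using div_mod_cancel[of i n j] ij(3) that by blast
    then show "0 \<le> (1\<^sub>m m \<otimes>\<^sub>K A) $$ (i, j)"
      using assms ij by (auto simp: generator_mat_def kron_index[OF one_carrier_mat A] div_mod_less)
  next
    fix i assume i: "i < m * n"
    then show "(\<Sum>j<m * n. (1\<^sub>m m \<otimes>\<^sub>K A) $$ (i, j)) = 0"
      using assms unfolding kron_row_sum[OF one_carrier_mat A i]
      by (simp add: generator_mat_def div_mod_less)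
  qed
qed

lemma generator_mat_kron_one_right:
  assumes "generator_mat n A"
  shows "generator_mat (n * m) (A \<otimes>\<^sub>K 1\<^sub>m m)"
proof -
  have A: "A \<in> carrier_mat n n" using assms by (simp add: generator_mat_def)
  show ?thesis
    unfolding generator_mat_def
  proof (intro conjI allI impI)
    show "A \<otimes>\<^sub>K 1\<^sub>m m \<in> carrier_mat (n * m) (n * m)"
      by (rule kron_carrier[OF A one_carrier_mat])
  next
    fix i j assume ij: "i < n * m" "j < n * m" "i \<noteq> j"
    have "i div m \<noteq> j div m" if "i mod m = j mod m"
      using div_mod_cancel[of i m j] ij(3) that by blast
    then show "0 \<le> (A \<otimes>\<^sub>K 1\<^sub>m m) $$ (i, j)"
      using assms ij by (auto simp: generator_mat_def kron_index[OF A one_carrier_mat] div_mod_less)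
  next
    fix i assume i: "i < n * m"
    then show "(\<Sum>j<n * m. (A \<otimes>\<^sub>K 1\<^sub>m m) $$ (i, j)) = 0"
      using assms unfolding kron_row_sum[OF A one_carrier_mat i]
      by (simp add: generator_mat_def div_mod_less)
  qed
qed

lemma kron_one_one: "1\<^sub>m m \<otimes>\<^sub>K 1\<^sub>m n = (1\<^sub>m (m * n) :: real mat)"
  by (rule eq_matI) (auto dest: div_mod_cancel simp: kron_def div_mod_less)

lemma generator_mat_D_h:
  assumes "length ns \<in> {1, 2, 3}" "\<forall>k<length ns. 2 \<le> ns ! k"
  shows "generator_mat (prod_list ns) (D_h h ns)"
proof -
  have lam: "generator_mat (ns ! k) (lambda_h h (ns ! k))" if "k < length ns" for k
    using assms(2) that by (intro generator_mat_lambda_h) auto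
  note L = generator_mat_kron_one_left and R = generator_mat_kron_one_right
  consider p where "ns = [p]" | p q where "ns = [p, q]" | p q r where "ns = [p, q, r]"
    using assms(1) by (auto simp: length_Suc_conv numeral_eq_Suc)
  then show ?thesis
  proof cases
    case 1
    then show ?thesis using lam[of 0] by simp
  next
    case (2 p q)
    then have "generator_mat p (lambda_h h p)" "generator_mat q (lambda_h h q)"
      using lam[of 0] lam[of 1] by auto
    then show ?thesis
      using 2 L[of p "lambda_h h p" q] R[of q "lambda_h h q" p]
      by (simp add: generator_mat_add mult.commute)
  next
    case (3 p q r)
    then have "generator_mat p (lambda_h h p)" "generator_mat q (lambda_h h q)"
      "generator_mat r (lambda_h h r)"
      using lam[of 0] lam[of 1] lam[of 2] by auto
    \<comment> \<open>Kronecker products associate to the right. In the third summand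
      \<open>kron_one_one\<close> merges the adjacent identities before \<open>R\<close> applies;
      the other two start by splitting off the left identity with \<open>L\<close>.\<close>
    then have "generator_mat (r * (q * p)) (1\<^sub>m r \<otimes>\<^sub>K 1\<^sub>m q \<otimes>\<^sub>K lambda_h h p)"
      "generator_mat (r * (q * p)) (1\<^sub>m r \<otimes>\<^sub>K lambda_h h q \<otimes>\<^sub>K 1\<^sub>m p)"
      "generator_mat (r * (q * p)) (lambda_h h r \<otimes>\<^sub>K 1\<^sub>m q \<otimes>\<^sub>K 1\<^sub>m p)"
      by (auto simp: kron_one_one intro!: L R)
    then have "generator_mat (r * (q * p)) (D_h h ns)"
      using 3 by (simp add: generator_mat_add)
    moreover have "prod_list ns = r * (q * p)"
      using 3 by simp
    ultimately show ?thesis by simp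
  qed
qed

section \<open>Matrix powers and the exponential series\<close>

lemma pow_mat_index_Suc:
  assumes A: "A \<in> carrier_mat n n" and ij: "i < n" "j < n"
  shows "(A ^\<^sub>m Suc k) $$ (i, j) = (\<Sum>l<n. (A ^\<^sub>m k) $$ (i, l) * A $$ (l, j))"
  using mult_mat_index_sum[OF pow_carrier_mat[OF A] A ij] by simp

lemma pow_mat_commute:
  fixes A :: "'a :: comm_ring_1 mat"
  assumes A: "A \<in> carrier_mat n n"
  shows "A ^\<^sub>m k * A = A * A ^\<^sub>m k"
proof (induction k)
  case (Suc k)
  have "A ^\<^sub>m Suc k * A = A * A ^\<^sub>m k * A" using Suc by simp
  also have "\<dots> = A * (A ^\<^sub>m k * A)"
    using A by (intro assoc_mult_mat) auto
  finally show ?case by simp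
qed (use A in simp)

lemma pow_mat_zero_row_sum:
  assumes "A \<in> carrier_mat n n" "i < n"
  shows "(\<Sum>j<n. (A ^\<^sub>m 0) $$ (i, j)) = (1 :: real)"
proof -
  have "(\<Sum>j<n. (A ^\<^sub>m 0) $$ (i, j)) = (\<Sum>j<n. if j = i then 1 else 0)"
    using assms by (intro sum.cong) auto
  then show ?thesis using assms(2) by simp
qed

text \<open>The largest absolute row sum is submultiplicative. The resulting geometric growth bound
  on the entries of the powers yields convergence of the exponential series.\<close>

lemma pow_mat_abs_row_sum_le:
  fixes A :: "real mat"
  assumes A: "A \<in> carrier_mat n n" and c: "\<And>i. i < n \<Longrightarrow> (\<Sum>j<n. \<bar>A $$ (i, j)\<bar>) \<le> c"
    and i: "i < n"
  shows "(\<Sum>j<n. \<bar>(A ^\<^sub>m k) $$ (i, j)\<bar>) \<le> c ^ k"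
proof (induction k)
  case 0
  have "(\<Sum>j<n. \<bar>(A ^\<^sub>m 0) $$ (i, j)\<bar>) = (\<Sum>j<n. (A ^\<^sub>m 0) $$ (i, j))"
    using A i by (intro sum.cong) auto
  then show ?case using pow_mat_zero_row_sum[OF A i] by simp
next
  case (Suc k)
  have c0: "0 \<le> c" using c[OF i] by (meson abs_ge_zero order_trans sum_nonneg)
  have "(\<Sum>j<n. \<bar>(A ^\<^sub>m Suc k) $$ (i, j)\<bar>)
      \<le> (\<Sum>j<n. \<Sum>l<n. \<bar>(A ^\<^sub>m k) $$ (i, l)\<bar> * \<bar>A $$ (l, j)\<bar>)"
  proof (rule sum_mono)
    fix j assume j: "j \<in> {..<n}"
    show "\<bar>(A ^\<^sub>m Suc k) $$ (i, j)\<bar> \<le> (\<Sum>l<n. \<bar>(A ^\<^sub>m k) $$ (i, l)\<bar> * \<bar>A $$ (l, j)\<bar>)"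
      using pow_mat_index_Suc[OF A i, of j k] j
        sum_abs[of "\<lambda>l. (A ^\<^sub>m k) $$ (i, l) * A $$ (l, j)" "{..<n}"]
      by (simp add: abs_mult del: pow_mat.simps)
  qed
  also have "\<dots> = (\<Sum>l<n. \<bar>(A ^\<^sub>m k) $$ (i, l)\<bar> * (\<Sum>j<n. \<bar>A $$ (l, j)\<bar>))"
    by (subst sum.swap) (simp add: sum_distrib_left)
  also have "\<dots> \<le> (\<Sum>l<n. \<bar>(A ^\<^sub>m k) $$ (i, l)\<bar> * c)"
    using c by (intro sum_mono mult_left_mono) auto
  also have "\<dots> \<le> c ^ k * c"
    unfolding sum_distrib_right[symmetric] using Suc c0 by (intro mult_right_mono)
  finally show ?case by (simp add: mult.commute)
qed

lemma smult_pow_mat: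
  fixes A :: "'a :: comm_ring_1 mat"
  assumes A: "A \<in> carrier_mat n n"
  shows "(s \<cdot>\<^sub>m A) ^\<^sub>m k = s ^ k \<cdot>\<^sub>m (A ^\<^sub>m k)"
proof (induction k)
  case 0
  then show ?case using A by (intro eq_matI) auto
next
  case (Suc k)
  have "(s ^ k \<cdot>\<^sub>m (A ^\<^sub>m k)) * (s \<cdot>\<^sub>m A) = (s ^ k * s) \<cdot>\<^sub>m (A ^\<^sub>m k * A)"
    using A pow_carrier_mat[OF A, of k]
    by (auto intro!: eq_matI simp: mult_smult_distrib[of _ n n _ n] mult_smult_assoc_mat[of _ n n _ n] algebra_simps)
  then show ?case using Suc by (simp add: mult.commute)
qed

text \<open>Moving the scalar out of the powers turns every entry into a scalar power series in
  \<open>s\<close>, ready for termwise differentiation.\<close>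

lemma exp_mat_index:
  assumes A: "A \<in> carrier_mat n n" and ij: "i < n" "j < n"
  shows "exp_mat (s \<cdot>\<^sub>m A) $$ (i, j) = (\<Sum>k. (A ^\<^sub>m k) $$ (i, j) / fact k * s ^ k)"
proof -
  have "((s \<cdot>\<^sub>m A) ^\<^sub>m k) $$ (i, j) / fact k = (A ^\<^sub>m k) $$ (i, j) / fact k * s ^ k" for k
    using A ij pow_carrier_mat[OF A, of k] by (simp add: smult_pow_mat[OF A])
  then show ?thesis using A ij by (simp add: exp_mat_def)
qed

text \<open>The infinite sum in \<open>exp_mat\<close> is meaningful only if it converges. The
  scalar exponential series at \<open>?c * \<bar>s\<bar>\<close> is a majorant, since the entries of
  the powers grow at most geometrically.\<close>

lemma exp_mat_sums:
  assumes A: "A \<in> carrier_mat n n" and ij: "i < n" "j < n"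
  shows "(\<lambda>k. (A ^\<^sub>m k) $$ (i, j) / fact k * s ^ k) sums exp_mat (s \<cdot>\<^sub>m A) $$ (i, j)"
proof -
  let ?c = "\<Sum>i<n. \<Sum>j<n. \<bar>A $$ (i, j)\<bar>"
  have row: "(\<Sum>j<n. \<bar>A $$ (i, j)\<bar>) \<le> ?c" if "i < n" for i
    using that by (intro member_le_sum[of i "{..<n}" "\<lambda>i. \<Sum>j<n. \<bar>A $$ (i, j)\<bar>"])
      (auto intro: sum_nonneg)
  have entry: "\<bar>(A ^\<^sub>m k) $$ (i, j)\<bar> \<le> ?c ^ k" for k
  proof -
    have "\<bar>(A ^\<^sub>m k) $$ (i, j)\<bar> \<le> (\<Sum>j<n. \<bar>(A ^\<^sub>m k) $$ (i, j)\<bar>)"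
      using ij by (intro member_le_sum[of j "{..<n}" "\<lambda>j. \<bar>(A ^\<^sub>m k) $$ (i, j)\<bar>"]) auto
    then show ?thesis using pow_mat_abs_row_sum_le[OF A row ij(1), of k] by linarith
  qed
  have bound: "norm ((A ^\<^sub>m k) $$ (i, j) / fact k * s ^ k) \<le> (?c * \<bar>s\<bar>) ^ k / fact k" for k
    using mult_right_mono[OF entry[of k], of "\<bar>s\<bar> ^ k"]
    by (simp add: abs_mult power_abs power_mult_distrib divide_right_mono)
  have "summable (\<lambda>k. (?c * \<bar>s\<bar>) ^ k / fact k)"
    using summable_exp[of "?c * \<bar>s\<bar>"] by (simp add: field_simps)
  then have "summable (\<lambda>k. (A ^\<^sub>m k) $$ (i, j) / fact k * s ^ k)"
    by (rule summable_comparison_test'[of _ 0]) (rule bound)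
  then show ?thesis
    unfolding exp_mat_index[OF A ij] by (rule summable_sums)
qed

lemma exp_mat_zero_index:
  assumes A: "A \<in> carrier_mat n n" and ij: "i < n" "j < n"
  shows "exp_mat (0 \<cdot>\<^sub>m A) $$ (i, j) = (if i = j then 1 else 0)"
  unfolding exp_mat_index[OF A ij] powser_zero using A ij by simp

text \<open>Termwise differentiation shifts the coefficients by one; splitting off the last factor
  of the power then leaves \<open>A\<close> on the right.\<close>

lemma exp_mat_DERIV:
  assumes A: "A \<in> carrier_mat n n" and ij: "i < n" "j < n"
  shows "((\<lambda>s. exp_mat (s \<cdot>\<^sub>m A) $$ (i, j)) has_real_derivative
    (\<Sum>l<n. exp_mat (s \<cdot>\<^sub>m A) $$ (i, l) * A $$ (l, j))) (at s)"
proof -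
  let ?a = "\<lambda>j k. (A ^\<^sub>m k) $$ (i, j) / fact k"
  have "((\<lambda>s. \<Sum>k. ?a j k * s ^ k) has_real_derivative (\<Sum>k. diffs (?a j) k * s ^ k)) (at s)"
    by (intro termdiffs_strong_converges_everywhere sums_summable[OF exp_mat_sums[OF A ij]])
  moreover have "diffs (?a j) k * s ^ k = (\<Sum>l<n. (?a l k * s ^ k) * A $$ (l, j))" for k
  proof -
    have "diffs (?a j) k = (A ^\<^sub>m Suc k) $$ (i, j) / fact k"
      by (simp add: diffs_def field_simps del: pow_mat.simps of_nat_Suc)
    also have "\<dots> = (\<Sum>l<n. ?a l k * A $$ (l, j))"
      by (simp add: pow_mat_index_Suc[OF A ij] sum_divide_distrib del: pow_mat.simps)
    finally show ?thesis by (simp add: sum_distrib_left sum_distrib_right mult_ac)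
  qed
  moreover have "(\<lambda>k. \<Sum>l<n. (?a l k * s ^ k) * A $$ (l, j)) sums
      (\<Sum>l<n. exp_mat (s \<cdot>\<^sub>m A) $$ (i, l) * A $$ (l, j))"
    using exp_mat_sums[OF A ij(1)] by (intro sums_sum sums_mult2) auto
  moreover have "(\<lambda>s. exp_mat (s \<cdot>\<^sub>m A) $$ (i, j)) = (\<lambda>s. \<Sum>k. ?a j k * s ^ k)"
    using exp_mat_index[OF A ij] by auto
  ultimately show ?thesis
    by (simp add: sums_iff)
qed

text \<open>Every power of \<open>A\<close> commutes with \<open>A\<close>, and the series inherits
  this. It moves the \<open>A\<close> produced by \<open>exp_mat_DERIV\<close> to the left, where a
  linear system has it.\<close>

lemma exp_mat_commute:
  assumes A: "A \<in> carrier_mat n n" and ij: "i < n" "j < n"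
  shows "(\<Sum>l<n. exp_mat (s \<cdot>\<^sub>m A) $$ (i, l) * A $$ (l, j)) =
    (\<Sum>l<n. A $$ (i, l) * exp_mat (s \<cdot>\<^sub>m A) $$ (l, j))"
proof -
  let ?a = "\<lambda>i j k. (A ^\<^sub>m k) $$ (i, j) / fact k * s ^ k"
  have "(\<Sum>l<n. (A ^\<^sub>m k) $$ (i, l) * A $$ (l, j)) =
      (\<Sum>l<n. A $$ (i, l) * (A ^\<^sub>m k) $$ (l, j))" for k
    using mult_mat_index_sum[OF A pow_carrier_mat[OF A] ij]
      mult_mat_index_sum[OF pow_carrier_mat[OF A] A ij] pow_mat_commute[OF A, of k] by metis
  then have "(\<Sum>l<n. (A ^\<^sub>m k) $$ (i, l) * A $$ (l, j)) * (s ^ k / fact k) =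
      (\<Sum>l<n. A $$ (i, l) * (A ^\<^sub>m k) $$ (l, j)) * (s ^ k / fact k)" for k
    by simp
  then have eq: "(\<Sum>l<n. ?a i l k * A $$ (l, j)) = (\<Sum>l<n. A $$ (i, l) * ?a l j k)" for k
    by (simp only: sum_distrib_right) (simp add: mult_ac)
  have "(\<lambda>k. \<Sum>l<n. ?a i l k * A $$ (l, j)) sums
      (\<Sum>l<n. exp_mat (s \<cdot>\<^sub>m A) $$ (i, l) * A $$ (l, j))"
    using exp_mat_sums[OF A ij(1)] by (intro sums_sum sums_mult2) auto
  moreover have "(\<lambda>k. \<Sum>l<n. A $$ (i, l) * ?a l j k) sums
      (\<Sum>l<n. A $$ (i, l) * exp_mat (s \<cdot>\<^sub>m A) $$ (l, j))"
    using exp_mat_sums[OF A _ ij(2)] by (intro sums_sum sums_mult) auto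
  ultimately show ?thesis
    unfolding eq by (rule sums_unique2)
qed

text \<open>The differential form of Duhamel's formula: the contributions of \<open>A\<close> cancel.\<close>

lemma exp_mat_duhamel_DERIV:
  assumes A: "A \<in> carrier_mat n n" and i: "i < n"
    and y: "\<And>j. j < n \<Longrightarrow>
      ((\<lambda>r. y r j) has_real_derivative (\<Sum>l<n. A $$ (j, l) * y r l) + g j) (at r)"
  shows "((\<lambda>r. \<Sum>j<n. exp_mat ((s - r) \<cdot>\<^sub>m A) $$ (i, j) * y r j) has_real_derivative
    (\<Sum>j<n. exp_mat ((s - r) \<cdot>\<^sub>m A) $$ (i, j) * g j)) (at r)"
proof -
  let ?E = "\<lambda>r j. exp_mat ((s - r) \<cdot>\<^sub>m A) $$ (i, j)"
  have E: "((\<lambda>r. ?E r j) has_real_derivative - (\<Sum>l<n. ?E r l * A $$ (l, j))) (at r)"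
    if "j < n" for j
  proof -
    have "((\<lambda>r. s - r) has_real_derivative - 1) (at r)"
      by (auto intro!: derivative_eq_intros)
    from DERIV_chain2[OF exp_mat_DERIV[OF A i that] this] show ?thesis by simp
  qed
  have "((\<lambda>r. \<Sum>j<n. ?E r j * y r j) has_real_derivative
      (\<Sum>j<n. - (\<Sum>l<n. ?E r l * A $$ (l, j)) * y r j
        + ((\<Sum>l<n. A $$ (j, l) * y r l) + g j) * ?E r j)) (at r)"
    by (intro DERIV_sum DERIV_mult E y) auto
  moreover have "(\<Sum>j<n. - (\<Sum>l<n. ?E r l * A $$ (l, j)) * y r j
        + ((\<Sum>l<n. A $$ (j, l) * y r l) + g j) * ?E r j)
      = (\<Sum>j<n. ?E r j * g j) + ((\<Sum>j<n. (\<Sum>l<n. A $$ (j, l) * y r l) * ?E r j)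
        - (\<Sum>j<n. (\<Sum>l<n. ?E r l * A $$ (l, j)) * y r j))"
    unfolding sum_subtractf[symmetric] sum.distrib[symmetric]
    by (intro sum.cong) (simp_all add: algebra_simps)
  moreover have "(\<Sum>j<n. (\<Sum>l<n. ?E r l * A $$ (l, j)) * y r j)
      = (\<Sum>j<n. (\<Sum>l<n. A $$ (j, l) * y r l) * ?E r j)"
    unfolding sum_distrib_right by (subst sum.swap) (simp add: mult_ac)
  ultimately show ?thesis by simp
qed

section \<open>Mean value bound, uniqueness and estimates for the exponential\<close>

text \<open>Differentiability is asked only in the interior, because at the ends of the time
  interval \<open>solves_ode\<close> provides no two-sided derivative.\<close>

lemma mvt_abs_bound:
  fixes g g' :: "real \<Rightarrow> real"
  assumes "a \<le> b" "continuous_on {a..b} g"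
    and "\<And>x. a < x \<Longrightarrow> x < b \<Longrightarrow> (g has_real_derivative g' x) (at x)"
    and "\<And>x. a < x \<Longrightarrow> x < b \<Longrightarrow> \<bar>g' x\<bar> \<le> K"
  shows "\<bar>g b - g a\<bar> \<le> K * (b - a)"
proof (cases "a < b")
  case True
  obtain x where "a < x" "x < b" "g b - g a = g' x * (b - a)"
  proof (rule mvt[OF True assms(2)])
    show "(g has_derivative (*) (g' x)) (at x)" if "a < x" "x < b" for x
      using assms(3)[OF that] by (simp add: has_field_derivative_def)
  qed
  then show ?thesis
    using assms(4)[of x] True by (simp add: abs_mult mult_right_mono)
qed (use assms(1) in simp)

text \<open>By the Duhamel derivative with \<open>g = 0\<close>, the function
  \<open>exp ((s - r) A) y(r)\<close> is constant in \<open>r\<close>. Its values at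
  \<open>r = s\<close> and \<open>r = 0\<close> are the two sides.\<close>

lemma exp_mat_linear_ode_unique:
  assumes A: "A \<in> carrier_mat n n" and i: "i < n" and s: "0 \<le> s"
    and y: "\<And>r j. j < n \<Longrightarrow>
      ((\<lambda>r. y r j) has_real_derivative (\<Sum>l<n. A $$ (j, l) * y r l)) (at r)"
  shows "y s i = (\<Sum>j<n. exp_mat (s \<cdot>\<^sub>m A) $$ (i, j) * y 0 j)"
proof -
  let ?g = "\<lambda>r. \<Sum>j<n. exp_mat ((s - r) \<cdot>\<^sub>m A) $$ (i, j) * y r j"
  have D: "(?g has_real_derivative 0) (at r)" for r
    using exp_mat_duhamel_DERIV[OF A i, where g = "\<lambda>_. 0"] y by simp
  then have "?g s = ?g 0"
    using DERIV_const_ratio_const DERIV_isconst_all by blast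
  moreover have "?g s = (\<Sum>j<n. if i = j then y s j else 0)"
    using exp_mat_zero_index[OF A i] by (intro sum.cong) auto
  ultimately show ?thesis using i by simp
qed

text \<open>Nonnegativity and constant row sums pass through matrix products, the row sums being
  multiplied. Both facts then carry over term by term to the exponential series.\<close>

lemma pow_mat_nonneg_row_sum:
  assumes P: "P \<in> carrier_mat n n" and pos: "\<And>i j. i < n \<Longrightarrow> j < n \<Longrightarrow> 0 \<le> P $$ (i, j)"
    and row: "\<And>i. i < n \<Longrightarrow> (\<Sum>j<n. P $$ (i, j)) = c" and i: "i < n"
  shows "(\<forall>j<n. 0 \<le> (P ^\<^sub>m k) $$ (i, j)) \<and> (\<Sum>j<n. (P ^\<^sub>m k) $$ (i, j)) = (c :: real) ^ k"
proof (induction k)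
  case 0
  then show ?case using P i pow_mat_zero_row_sum[OF P i] by auto
next
  case (Suc k)
  have "(\<Sum>j<n. (P ^\<^sub>m Suc k) $$ (i, j)) = (\<Sum>l<n. (P ^\<^sub>m k) $$ (i, l) * (\<Sum>j<n. P $$ (l, j)))"
    by (simp add: pow_mat_index_Suc[OF P i] sum_distrib_left del: pow_mat.simps)
      (rule sum.swap)
  also have "\<dots> = c ^ Suc k"
    using Suc row by (simp add: sum_distrib_right[symmetric])
  finally show ?case
    using Suc pos by (auto simp: pow_mat_index_Suc[OF P i] intro!: sum_nonneg
        simp del: pow_mat.simps)
qed

text \<open>After the shift \<open>P = A + c I \<ge> 0\<close>, the matrix \<open>exp (s P)\<close> is nonnegative with row sums
  \<open>exp (c s)\<close>.  The identity \<open>exp (s A) = exp (- c s) exp (s P)\<close> comes from uniqueness for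
  the linear system.\<close>

lemma generator_mat_exp_contraction:
  assumes gen: "generator_mat n A" and s: "0 \<le> s" and i: "i < n"
    and v: "\<And>j. j < n \<Longrightarrow> \<bar>v j\<bar> \<le> b"
  shows "\<bar>\<Sum>j<n. exp_mat (s \<cdot>\<^sub>m A) $$ (i, j) * v j\<bar> \<le> b"
proof -
  have A: "A \<in> carrier_mat n n" using gen by (simp add: generator_mat_def)
  \<comment> \<open>The sum dominates every single diagonal entry in absolute value, so one shift
    makes the whole diagonal of \<open>P\<close> nonnegative.\<close>
  define c where "c = (\<Sum>i<n. \<bar>A $$ (i, i)\<bar>)"
  define P where "P = A + c \<cdot>\<^sub>m 1\<^sub>m n"
  have P: "P \<in> carrier_mat n n" using A by (simp add: P_def)
  have Pij: "P $$ (i, j) = A $$ (i, j) + (if i = j then c else 0)" if "i < n" "j < n" for i j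
    using A that by (simp add: P_def)
  have diag: "\<bar>A $$ (i, i)\<bar> \<le> c" if "i < n" for i
    unfolding c_def using that by (intro member_le_sum[of i "{..<n}" "\<lambda>i. \<bar>A $$ (i, i)\<bar>"]) auto
  have pos: "0 \<le> P $$ (i, j)" if "i < n" "j < n" for i j
    using gen that diag[of i] by (auto simp: generator_mat_def Pij)
  have row: "(\<Sum>j<n. P $$ (i, j)) = c" if "i < n" for i
    using gen that by (auto simp: generator_mat_def Pij sum.distrib)
  let ?E = "\<lambda>s i j. exp_mat (s \<cdot>\<^sub>m P) $$ (i, j)"
  have pw_nonneg: "0 \<le> (P ^\<^sub>m k) $$ (i, j)" if "j < n" for j k
    using pow_mat_nonneg_row_sum[OF P _ _ i, of c k] pos row that by blast
  have pw_sum: "(\<Sum>j<n. (P ^\<^sub>m k) $$ (i, j)) = c ^ k" for k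
    using pow_mat_nonneg_row_sum[OF P _ _ i, of c k] pos row by blast
  have E_pos: "0 \<le> ?E s i j" if "j < n" for j
  proof (rule sums_le[OF _ sums_zero exp_mat_sums[OF P i that]])
    show "0 \<le> (P ^\<^sub>m k) $$ (i, j) / fact k * s ^ k" for k
      using pw_nonneg[OF that] s by simp
  qed
  have E_row: "(\<Sum>j<n. ?E s i j) = exp (c * s)"
  proof -
    have "(\<lambda>k. \<Sum>j<n. (P ^\<^sub>m k) $$ (i, j) / fact k * s ^ k) sums (\<Sum>j<n. ?E s i j)"
      using exp_mat_sums[OF P i] by (intro sums_sum) auto
    moreover have "(\<Sum>j<n. (P ^\<^sub>m k) $$ (i, j) / fact k * s ^ k) = (c * s) ^ k /\<^sub>R fact k" for k
    proof -
      have "(\<Sum>j<n. (P ^\<^sub>m k) $$ (i, j) / fact k * s ^ k) = c ^ k / fact k * s ^ k"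
        by (simp only: pw_sum sum_distrib_right[symmetric] sum_divide_distrib[symmetric])
      then show ?thesis by (simp add: power_mult_distrib field_simps)
    qed
    ultimately show ?thesis
      using exp_converges[of "c * s"] by (simp add: sums_unique2)
  qed
  define S where "S r i = (\<Sum>j<n. ?E r i j * v j)" for r i
  \<comment> \<open>The exponential factor cancels the term \<open>c * S r k\<close> caused by the
    shift, so \<open>?y\<close> solves the linear system of \<open>A\<close> with initial value
    \<open>v\<close>.\<close>
  let ?y = "\<lambda>r i. exp (- (c * r)) * S r i"
  have "((\<lambda>r. ?y r k) has_real_derivative (\<Sum>l<n. A $$ (k, l) * ?y r l)) (at r)"
    if k: "k < n" for r k
  proof -
    have "(S' has_real_derivative (\<Sum>j<n. (\<Sum>l<n. P $$ (k, l) * ?E r l j) * v j)) (at r)"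
      if "S' = (\<lambda>r. S r k)" for S'
      unfolding that S_def using exp_mat_DERIV[OF P k] exp_mat_commute[OF P k]
      by (intro DERIV_sum DERIV_cmult_right) auto
    moreover have "(\<Sum>j<n. (\<Sum>l<n. P $$ (k, l) * ?E r l j) * v j)
        = (\<Sum>l<n. P $$ (k, l) * S r l)"
      unfolding S_def sum_distrib_right sum_distrib_left by (subst sum.swap) (simp add: mult_ac)
    moreover have "\<dots> = (\<Sum>l<n. A $$ (k, l) * S r l) + c * S r k"
      using k by (simp add: Pij distrib_right sum.distrib if_distrib[of "\<lambda>x. x * _"] cong: if_cong)
    ultimately have "((\<lambda>r. S r k) has_real_derivative
        (\<Sum>l<n. A $$ (k, l) * S r l) + c * S r k) (at r)" by simp
    then have "((\<lambda>r. ?y r k) has_real_derivative exp (- (c * r)) * (- c) * S r k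
        + ((\<Sum>l<n. A $$ (k, l) * S r l) + c * S r k) * exp (- (c * r))) (at r)"
      by (intro DERIV_mult) (auto intro!: derivative_eq_intros)
    moreover have "(\<Sum>l<n. A $$ (k, l) * ?y r l) = exp (- (c * r)) * (\<Sum>l<n. A $$ (k, l) * S r l)"
      by (simp add: sum_distrib_left mult_ac)
    ultimately show ?thesis
      by (simp add: algebra_simps)
  qed
  from exp_mat_linear_ode_unique[where y = ?y, OF A i s this]
  have "?y s i = (\<Sum>j<n. exp_mat (s \<cdot>\<^sub>m A) $$ (i, j) * ?y 0 j)"
    by simp
  moreover have "?y 0 j = v j" if "j < n" for j
  proof -
    have "S 0 j = (\<Sum>l<n. if j = l then v l else 0)"
      unfolding S_def using exp_mat_zero_index[OF P that] by (intro sum.cong) auto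
    then show ?thesis using that by simp
  qed
  moreover have "\<bar>S s i\<bar> \<le> exp (c * s) * b"
  proof -
    have "\<bar>S s i\<bar> \<le> (\<Sum>j<n. ?E s i j * \<bar>v j\<bar>)"
      using E_pos sum_abs[of "\<lambda>j. ?E s i j * v j" "{..<n}"] by (simp add: S_def abs_mult)
    also have "\<dots> \<le> (\<Sum>j<n. ?E s i j * b)"
      using E_pos v by (intro sum_mono mult_left_mono) auto
    finally show ?thesis using E_row by (simp add: sum_distrib_right[symmetric])
  qed
  ultimately show ?thesis
    by (simp add: abs_mult exp_minus field_simps)
qed

lemma linf_mat_row_bound:
  assumes A: "A \<in> carrier_mat n n" and i: "i < n" and v: "\<And>j. j < n \<Longrightarrow> \<bar>v j\<bar> \<le> b"
  shows "\<bar>\<Sum>j<n. A $$ (i, j) * v j\<bar> \<le> linf_mat A * b"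
proof -
  have n: "0 < n" using i by simp
  have c: "vec n v \<in> carrier_vec n" "A *\<^sub>v vec n v \<in> carrier_vec n" using A by auto
  have "\<bar>(A *\<^sub>v vec n v) $ i\<bar> \<le> linf_mat A * linf_vec (vec n v)"
    using linf_mat_bound[OF A c(1) n] linf_vec_le_iff[OF c(2) n] i by blast
  also have "\<dots> \<le> linf_mat A * b"
    using linf_vec_le_iff[OF c(1) n, of b] v linf_mat_nonneg[OF A n]
    by (intro mult_left_mono) auto
  finally show ?thesis
    unfolding mult_mat_vec_index_sum[OF A c(1) i] by simp
qed

text \<open>The derivative of \<open>exp (r A) v\<close> in \<open>r\<close> is
  \<open>exp (r A) (A v)\<close>. By contraction it is no larger than the bound
  \<open>linf_mat A * b\<close> on \<open>A v\<close>, and the mean value bound supplies the factor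
  \<open>s\<close>.\<close>

lemma generator_mat_exp_near_id:
  assumes gen: "generator_mat n A" and s: "0 \<le> s" and i: "i < n"
    and v: "\<And>j. j < n \<Longrightarrow> \<bar>v j\<bar> \<le> b"
  shows "\<bar>(\<Sum>j<n. exp_mat (s \<cdot>\<^sub>m A) $$ (i, j) * v j) - v i\<bar> \<le> linf_mat A * b * s"
proof -
  have A: "A \<in> carrier_mat n n" using gen by (simp add: generator_mat_def)
  let ?E = "\<lambda>r j. exp_mat (r \<cdot>\<^sub>m A) $$ (i, j)"
  let ?g = "\<lambda>r. \<Sum>j<n. ?E r j * v j"
  let ?g' = "\<lambda>r. \<Sum>l<n. ?E r l * (\<Sum>j<n. A $$ (l, j) * v j)"
  have D: "(?g has_real_derivative ?g' r) (at r)" for r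
  proof -
    have "(?g has_real_derivative (\<Sum>j<n. (\<Sum>l<n. ?E r l * A $$ (l, j)) * v j)) (at r)"
      using exp_mat_DERIV[OF A i] by (intro DERIV_sum DERIV_cmult_right) auto
    moreover have "(\<Sum>j<n. (\<Sum>l<n. ?E r l * A $$ (l, j)) * v j) = ?g' r"
      unfolding sum_distrib_right sum_distrib_left by (subst sum.swap) (simp add: mult_ac)
    ultimately show ?thesis by simp
  qed
  have "\<bar>?g s - ?g 0\<bar> \<le> linf_mat A * b * (s - 0)"
  proof (rule mvt_abs_bound[OF s])
    show "continuous_on {0..s} ?g"
      using D by (meson DERIV_isCont continuous_at_imp_continuous_on)
    show "\<bar>?g' r\<bar> \<le> linf_mat A * b" if "0 < r" for r
      using that v by (intro generator_mat_exp_contraction[OF gen _ i] linf_mat_row_bound[OF A]) auto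
  qed (rule D)
  moreover have "?g 0 = (\<Sum>j<n. if i = j then v j else 0)"
    using exp_mat_zero_index[OF A i] by (intro sum.cong) auto
  ultimately show ?thesis using i by simp
qed

section \<open>The nonlinearity on the invariant interval\<close>

text \<open>Compactness bounds the range from above, without which the real supremum in
  \<open>max_abs\<close> would carry no information.\<close>

lemma max_abs_upper:
  assumes "continuous_on {-\<beta>..\<beta>} g" "\<bar>x\<bar> \<le> \<beta>"
  shows "\<bar>g x\<bar> \<le> max_abs \<beta> g"
proof -
  have x: "x \<in> {-\<beta>..\<beta>}" using assms(2) by auto
  obtain y where "\<forall>z\<in>{-\<beta>..\<beta>}. \<bar>g z\<bar> \<le> \<bar>g y\<bar>"
    using continuous_attains_sup[of "{-\<beta>..\<beta>}" "\<lambda>x. \<bar>g x\<bar>"] x assms(1)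
    by (metis compact_Icc continuous_on_rabs empty_iff)
  then have "bdd_above ((\<lambda>x. \<bar>g x\<bar>) ` {-\<beta>..\<beta>})" by (auto intro!: bdd_aboveI2)
  then show ?thesis unfolding max_abs_def using x by (rule cSUP_upper2) simp
qed

lemma C1_on_interval_continuous:
  assumes "C1_on_interval \<beta> f f'"
  shows "continuous_on {-\<beta>..\<beta>} f"
  using assms unfolding C1_on_interval_def by (meson DERIV_continuous_on)

text \<open>The mean value theorem needs derivatives only at interior points, where the derivative
  within the closed interval is the ordinary one.\<close>

lemma C1_on_interval_mvt:
  assumes C1: "C1_on_interval \<beta> f f'" and xy: "-\<beta> \<le> x" "x < y" "y \<le> \<beta>"
  obtains z where "\<bar>z\<bar> \<le> \<beta>" "f y - f x = f' z * (y - x)"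
proof (rule mvt[of x y f "\<lambda>z. (*) (f' z)"])
  show "continuous_on {x..y} f"
    using C1_on_interval_continuous[OF C1] xy by (auto intro: continuous_on_subset)
  show "(f has_derivative (*) (f' z)) (at z)" if z: "x < z" "z < y" for z
  proof -
    have "at z within {-\<beta>..\<beta>} = at z" using xy z by (intro at_within_Icc_at) auto
    then show ?thesis
      using C1 xy z unfolding C1_on_interval_def has_field_derivative_def
      by (metis atLeastAtMost_iff less_eq_real_def order_trans)
  qed
next
  fix z assume "x < z" "z < y" "f y - f x = f' z * (y - x)"
  then show thesis using that[of z] xy by (simp add: abs_le_iff)
qed (rule xy)

lemma C1_on_interval_lipschitz:
  assumes C1: "C1_on_interval \<beta> f f'" and xy: "\<bar>x\<bar> \<le> \<beta>" "\<bar>y\<bar> \<le> \<beta>"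
  shows "\<bar>f x - f y\<bar> \<le> max_abs \<beta> f' * \<bar>x - y\<bar>"
proof -
  have *: "\<bar>f x - f y\<bar> \<le> max_abs \<beta> f' * \<bar>x - y\<bar>"
    if yx: "-\<beta> \<le> y" "y < x" "x \<le> \<beta>" for x y
  proof -
    obtain z where z: "\<bar>z\<bar> \<le> \<beta>" "f x - f y = f' z * (x - y)"
      using C1_on_interval_mvt[OF C1 yx] .
    have "\<bar>f' z\<bar> \<le> max_abs \<beta> f'"
      using C1 z(1) by (intro max_abs_upper) (auto simp: C1_on_interval_def)
    then show ?thesis using z(2) by (simp add: abs_mult mult_right_mono)
  qed
  show ?thesis
    using *[of y x] *[of x y] xy
    by (cases x y rule: linorder_cases) (auto simp: abs_minus_commute)
qed

text \<open>Otherwise the Lipschitz estimate would force \<open>f\<close> to equal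
  \<open>f 0\<close> on the whole interval. Positivity justifies the division by \<open>F1\<close>
  in the final constant.\<close>

lemma C1_on_interval_max_abs_pos:
  assumes C1: "C1_on_interval \<beta> f f'" and "\<not> (\<exists>c. \<forall>x\<in>{-\<beta>..\<beta>}. f x = c)"
  shows "0 < max_abs \<beta> f'"
proof (rule ccontr)
  assume neg: "\<not> 0 < max_abs \<beta> f'"
  have "f x = f 0" if "x \<in> {-\<beta>..\<beta>}" for x
  proof -
    have "\<bar>f x - f 0\<bar> \<le> max_abs \<beta> f' * \<bar>x - 0\<bar>"
      using that by (intro C1_on_interval_lipschitz[OF C1]) auto
    also have "\<dots> \<le> 0" using neg by (simp add: mult_nonpos_nonneg)
    finally show ?thesis by simp
  qed
  then show False using assms(2) by blast
qed

text \<open>A positive step size bounded by \<open>omega0\<close> forces the minimum of \<open>f'\<close> to be negative: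
  otherwise \<open>omega0\<close> would not be positive, its value being \<open>0\<close> when the minimum vanishes.\<close>

lemma explicit_euler_invariant:
  assumes C1: "C1_on_interval \<beta> f f'" and f: "f \<beta> \<le> 0" "0 \<le> f (- \<beta>)"
    and \<tau>: "0 < \<tau>" "\<tau> \<le> omega0 \<beta> f'" and x: "\<bar>x\<bar> \<le> \<beta>"
  shows "\<bar>x + \<tau> * f x\<bar> \<le> \<beta>"
proof -
  let ?I = "INF x\<in>{-\<beta>..\<beta>}. f' x"
  have cont: "continuous_on {-\<beta>..\<beta>} f'" using C1 by (simp add: C1_on_interval_def)
  have "bdd_below (f' ` {-\<beta>..\<beta>})"
    using max_abs_upper[OF cont]
    by (intro bdd_belowI2[of _ "- max_abs \<beta> f'"]) (force simp: abs_le_iff)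
  then have I: "?I \<le> f' z" if "\<bar>z\<bar> \<le> \<beta>" for z
    using that by (intro cINF_lower) auto
  have "?I < 0"
  proof (rule ccontr)
    assume "\<not> ?I < 0"
    then have "omega0 \<beta> f' \<le> 0" by (simp add: omega0_def)
    then show False using \<tau> by simp
  qed
  then have "- 1 \<le> \<tau> * ?I"
    using \<tau>(2) by (simp add: omega0_def field_simps)
  then have slope: "0 \<le> 1 + \<tau> * f' z" if "\<bar>z\<bar> \<le> \<beta>" for z
    using mult_left_mono[OF I[OF that], of \<tau>] \<tau>(1) by linarith
  have mono: "y + \<tau> * f y \<le> z + \<tau> * f z" if yz: "-\<beta> \<le> y" "y \<le> z" "z \<le> \<beta>" for y z
  proof (cases "y < z")
    case True
    obtain p where p: "\<bar>p\<bar> \<le> \<beta>" "f z - f y = f' p * (z - y)"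
      using C1_on_interval_mvt[OF C1 yz(1) True yz(3)] .
    have "(z + \<tau> * f z) - (y + \<tau> * f y) = (z - y) + \<tau> * (f z - f y)"
      by (simp add: algebra_simps)
    also have "\<dots> = (1 + \<tau> * f' p) * (z - y)" by (simp add: p(2) algebra_simps)
    also have "\<dots> \<ge> 0" using slope[OF p(1)] True by simp
    finally show ?thesis by simp
  qed (use yz in simp)
  \<comment> \<open>By monotonicity the value lies between the images of the two end points, and the
    sign conditions keep these images inside the interval.\<close>
  have "\<tau> * f \<beta> \<le> 0" "0 \<le> \<tau> * f (- \<beta>)" using f \<tau>(1) by (auto simp: mult_nonneg_nonpos)
  then show ?thesis
    using mono[of x \<beta>] mono[of "-\<beta>" x] x by (auto simp: abs_le_iff)
qed

text \<open>The idea is to compare \<open>exp ((s - r) A) u(r)\<close>, whose derivative in \<open>r\<close> is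
  \<open>exp ((s - r) A) f(u(r))\<close>, with the linear function of slope \<open>f(exp (\<tau> A) u(p))\<close> on the
  interval from \<open>p\<close> to \<open>s = p + \<tau>\<close>.\<close>

lemma LRI1b_local_error:
  assumes gen: "generator_mat n A" and C1: "C1_on_interval \<beta> f f'"
    and sol: "solves_ode A f v0 T u" and dim: "dim_vec v0 = n"
    and bound: "\<And>t j. 0 \<le> t \<Longrightarrow> t \<le> T \<Longrightarrow> j < n \<Longrightarrow> \<bar>u t $ j\<bar> \<le> \<beta>"
    and p: "0 \<le> p" and \<tau>: "0 < \<tau>" "p + \<tau> \<le> T" and i: "i < n"
    and w: "w = (\<Sum>j<n. exp_mat (\<tau> \<cdot>\<^sub>m A) $$ (i, j) * u p $ j)"
    and F0: "F0 = max_abs \<beta> f" and F1: "F1 = max_abs \<beta> f'"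
  shows "\<bar>u (p + \<tau>) $ i - (w + \<tau> * f w)\<bar>
    \<le> (linf_mat A * F0 + F1 * (2 * linf_mat A * \<beta> + F0)) * \<tau>\<^sup>2"
proof -
  let ?a = "linf_mat A" and ?s = "p + \<tau>"
  have A: "A \<in> carrier_mat n n" using gen by (simp add: generator_mat_def)
  have n: "0 < n" using i by simp
  have a0: "0 \<le> ?a" by (rule linf_mat_nonneg[OF A n])
  have carr: "u r \<in> carrier_vec n" if "0 \<le> r" "r \<le> T" for r
    using sol dim that by (auto simp: solves_ode_def)
  have cont_u: "continuous_on {0..T} (\<lambda>t. u t $ j)" if "j < n" for j
    using sol dim that by (auto simp: solves_ode_def)
  have f_bound: "\<bar>f (u r $ j)\<bar> \<le> F0" if "0 \<le> r" "r \<le> T" "j < n" for r j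
    unfolding F0 using max_abs_upper[OF C1_on_interval_continuous[OF C1] bound[OF that]] .
  have \<beta>0: "0 \<le> \<beta>" using bound[of p i] p \<tau> i by fastforce
  have F00: "0 \<le> F0" using f_bound[of p i] p \<tau> i by fastforce
  have F10: "0 \<le> F1"
    using max_abs_upper[of \<beta> f' 0] C1 \<beta>0 unfolding F1 C1_on_interval_def by force
  have D: "((\<lambda>r. u r $ j) has_real_derivative
      (\<Sum>l<n. A $$ (j, l) * u r $ l) + f (u r $ j)) (at r)"
    if r: "0 < r" "r < T" and j: "j < n" for r j
  proof -
    have "at r within {0..T} = at r" using r by (rule at_within_Icc_at)
    moreover have "(A *\<^sub>v u r + map_vec f (u r)) $ j
        = (\<Sum>l<n. A $$ (j, l) * u r $ l) + f (u r $ j)"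
      using A carr[of r] r j mult_mat_vec_index_sum[OF A carr[of r] j]
      by (simp del: index_mult_mat_vec)
    ultimately show ?thesis
      using sol dim r j by (force simp: solves_ode_def)
  qed
  let ?E = "\<lambda>r j. exp_mat ((?s - r) \<cdot>\<^sub>m A) $$ (i, j)"
  \<comment> \<open>The increment of \<open>?g\<close> from \<open>p\<close> to \<open>?s\<close> is
    exactly the local error: the sum equals \<open>u ?s $ i\<close> at \<open>?s\<close> and
    \<open>w\<close> at \<open>p\<close>, and the linear term contributes
    \<open>\<tau> * f w\<close>.\<close>
  let ?g = "\<lambda>r. (\<Sum>j<n. ?E r j * u r $ j) - f w * r"
  let ?g' = "\<lambda>r. (\<Sum>j<n. ?E r j * f (u r $ j)) - f w"
  \<comment> \<open>The first summand comes from replacing the exponential by the identity in front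
    of \<open>f (u r)\<close>, the second from the Lipschitz bound on
    \<open>f (u r $ i) - f w\<close>.\<close>
  let ?K = "?a * F0 + F1 * (2 * ?a * \<beta> + F0)"
  have "\<bar>?g ?s - ?g p\<bar> \<le> ?K * \<tau> * (?s - p)"
  proof (rule mvt_abs_bound[of p ?s ?g ?g'])
    have "continuous_on {p..?s} (\<lambda>r. ?E r j)" if "j < n" for j
    proof -
      have "isCont (\<lambda>r. exp_mat (r \<cdot>\<^sub>m A) $$ (i, j)) r" for r
        using exp_mat_DERIV[OF A i that] by (rule DERIV_isCont)
      then have "continuous_on UNIV (\<lambda>r. exp_mat (r \<cdot>\<^sub>m A) $$ (i, j))"
        by (simp add: continuous_at_imp_continuous_on)
      then show ?thesis
        by (rule continuous_on_compose2) (auto intro!: continuous_intros)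
    qed
    moreover have "continuous_on {p..?s} (\<lambda>r. u r $ j)" if "j < n" for j
      using cont_u[OF that] p \<tau> by (auto intro: continuous_on_subset)
    ultimately show "continuous_on {p..?s} ?g"
      by (intro continuous_intros) auto
  next
    fix r assume r: "p < r" "r < ?s"
    have rT: "0 < r" "r < T" using r p \<tau> by auto
    have "((\<lambda>r. \<Sum>j<n. ?E r j * u r $ j) has_real_derivative (\<Sum>j<n. ?E r j * f (u r $ j))) (at r)"
      using D[OF rT] by (intro exp_mat_duhamel_DERIV[OF A i])
    then show "(?g has_real_derivative ?g' r) (at r)"
      by (rule DERIV_diff) (auto intro!: derivative_eq_intros)
    have "\<bar>(\<Sum>j<n. ?E r j * f (u r $ j)) - f (u r $ i)\<bar> \<le> ?a * F0 * (?s - r)"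
      using r rT f_bound[of r] by (intro generator_mat_exp_near_id[OF gen _ i]) auto
    also have "\<dots> \<le> ?a * F0 * \<tau>"
      using r a0 F00 by (intro mult_left_mono) auto
    finally have 1: "\<bar>(\<Sum>j<n. ?E r j * f (u r $ j)) - f (u r $ i)\<bar> \<le> ?a * F0 * \<tau>" .
    \<comment> \<open>Both \<open>u r $ i\<close> and \<open>w\<close> are compared with
      \<open>u p $ i\<close>: the former through the size of the right-hand side of the equation,
      the latter through \<open>generator_mat_exp_near_id\<close>. Each comparison contributes one
      of the two terms \<open>?a * \<beta>\<close>.\<close>
    have "\<bar>u r $ i - u p $ i\<bar> \<le> (?a * \<beta> + F0) * (r - p)"
    proof (rule mvt_abs_bound[where g = "\<lambda>r. u r $ i"])
      show "continuous_on {p..r} (\<lambda>r. u r $ i)"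
        using cont_u[OF i] p r \<tau> by (auto intro: continuous_on_subset)
      fix q assume q: "p < q" "q < r"
      have qT: "0 < q" "q < T" using q p rT by auto
      show "((\<lambda>r. u r $ i) has_real_derivative
          (\<Sum>l<n. A $$ (i, l) * u q $ l) + f (u q $ i)) (at q)"
        by (rule D[OF qT i])
      have "\<bar>\<Sum>l<n. A $$ (i, l) * u q $ l\<bar> \<le> ?a * \<beta>"
        using bound qT by (intro linf_mat_row_bound[OF A i]) auto
      moreover have "\<bar>f (u q $ i)\<bar> \<le> F0" using f_bound[of q i] qT i by auto
      ultimately show "\<bar>(\<Sum>l<n. A $$ (i, l) * u q $ l) + f (u q $ i)\<bar> \<le> ?a * \<beta> + F0"
        by linarith
    qed (use r in simp)
    also have "\<dots> \<le> (?a * \<beta> + F0) * \<tau>"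
      using r a0 \<beta>0 F00 by (intro mult_left_mono) auto
    finally have "\<bar>u r $ i - u p $ i\<bar> \<le> (?a * \<beta> + F0) * \<tau>" .
    moreover have "\<bar>w - u p $ i\<bar> \<le> ?a * \<beta> * \<tau>"
      unfolding w using bound p \<tau> by (intro generator_mat_exp_near_id[OF gen _ i]) auto
    ultimately have "\<bar>u r $ i - w\<bar> \<le> (?a * \<beta> + F0) * \<tau> + ?a * \<beta> * \<tau>" by linarith
    also have "\<dots> = (2 * ?a * \<beta> + F0) * \<tau>" by (simp add: algebra_simps)
    finally have uw: "\<bar>u r $ i - w\<bar> \<le> (2 * ?a * \<beta> + F0) * \<tau>" .
    \<comment> \<open>The Lipschitz constant \<open>F1\<close> is valid only on the interval, so
      \<open>w\<close> has to lie there.\<close>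
    have "\<bar>w\<bar> \<le> \<beta>"
      unfolding w using bound p \<tau> by (intro generator_mat_exp_contraction[OF gen _ i]) auto
    then have "\<bar>f (u r $ i) - f w\<bar> \<le> F1 * \<bar>u r $ i - w\<bar>"
      unfolding F1 using bound[of r i] rT i by (intro C1_on_interval_lipschitz[OF C1]) auto
    also have "\<dots> \<le> F1 * ((2 * ?a * \<beta> + F0) * \<tau>)"
      using uw F10 by (rule mult_left_mono)
    finally show "\<bar>?g' r\<bar> \<le> ?K * \<tau>"
      using 1 by (simp add: algebra_simps)
  qed (use \<tau> in simp)
  moreover have "(\<Sum>j<n. ?E ?s j * u ?s $ j) = (\<Sum>j<n. if i = j then u ?s $ j else 0)"
    using exp_mat_zero_index[OF A i] by (intro sum.cong) auto
  ultimately show ?thesis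
    using i w by (simp add: algebra_simps power2_eq_square)
qed

section \<open>Discrete Gronwall argument and global error\<close>

text \<open>The sequence \<open>K / L * ((1 + \<tau> * L) ^ m - 1) * \<tau>\<close> starts at 0 and
  satisfies the recursion with equality, so it dominates \<open>e\<close>. The exponential enters
  through \<open>1 + x \<le> exp x\<close>.\<close>

lemma discrete_gronwall:
  fixes e :: "nat \<Rightarrow> real"
  assumes e0: "e 0 \<le> 0" and L: "0 < L" and \<tau>: "0 < \<tau>" and K: "0 \<le> K"
    and step: "\<And>m. m < M \<Longrightarrow> e (Suc m) \<le> (1 + \<tau> * L) * e m + K * \<tau>\<^sup>2"
    and m: "m \<le> M"
  shows "e m \<le> K / L * (exp (L * (real m * \<tau>)) - 1) * \<tau>"
proof -
  have "e m \<le> K / L * ((1 + \<tau> * L) ^ m - 1) * \<tau>"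
    using m
  proof (induction m)
    case (Suc m)
    have "(1 + \<tau> * L) * e m \<le> (1 + \<tau> * L) * (K / L * ((1 + \<tau> * L) ^ m - 1) * \<tau>)"
      using Suc L \<tau> by (intro mult_left_mono) auto
    then have "e (Suc m) \<le> (1 + \<tau> * L) * (K / L * ((1 + \<tau> * L) ^ m - 1) * \<tau>) + K * \<tau>\<^sup>2"
      using step[of m] Suc.prems by linarith
    also have "\<dots> = K / L * ((1 + \<tau> * L) ^ Suc m - 1) * \<tau>"
      using L by (simp add: field_simps power2_eq_square)
    finally show ?case .
  qed (use e0 in simp)
  also have "\<dots> \<le> K / L * (exp (L * (real m * \<tau>)) - 1) * \<tau>"
  proof -
    have "(1 + \<tau> * L) ^ m \<le> exp (\<tau> * L) ^ m"
      using L \<tau> by (intro power_mono exp_ge_add_one_self) auto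
    also have "\<dots> = exp (L * (real m * \<tau>))"
      by (simp add: exp_of_nat_mult[symmetric] mult_ac)
    finally show ?thesis
      using K L \<tau> by (intro mult_right_mono mult_left_mono) auto
  qed
  finally show ?thesis .
qed

lemma exp_mat_carrier:
  assumes "A \<in> carrier_mat n n"
  shows "exp_mat A \<in> carrier_mat n n"
  using assms by (simp add: exp_mat_def)

lemma LRI1b_carrier:
  assumes A: "A \<in> carrier_mat n n" and v: "v \<in> carrier_vec n"
  shows "LRI1b A f \<tau> v m \<in> carrier_vec n"
proof (induction m)
  case (Suc m)
  have "exp_mat (\<tau> \<cdot>\<^sub>m A) *\<^sub>v LRI1b A f \<tau> v m \<in> carrier_vec n"
    using exp_mat_carrier[of "\<tau> \<cdot>\<^sub>m A" n] A Suc by (intro mult_mat_vec_carrier) auto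
  then show ?case by (simp add: Let_def)
qed (use v in simp)

lemma LRI1b_Suc_index:
  fixes A :: "real mat"
  assumes A: "A \<in> carrier_mat n n" and v: "v \<in> carrier_vec n" and i: "i < n"
    and w: "w = (\<Sum>j<n. exp_mat (\<tau> \<cdot>\<^sub>m A) $$ (i, j) * LRI1b A f \<tau> v m $ j)"
  shows "LRI1b A f \<tau> v (Suc m) $ i = w + \<tau> * f w"
proof -
  have E: "exp_mat (\<tau> \<cdot>\<^sub>m A) \<in> carrier_mat n n" using A by (intro exp_mat_carrier) simp
  have "(exp_mat (\<tau> \<cdot>\<^sub>m A) *\<^sub>v LRI1b A f \<tau> v m) $ i = w"
    using mult_mat_vec_index_sum[OF E LRI1b_carrier[OF A v] i] w by simp
  then show ?thesis
    using E i by (simp add: Let_def del: index_mult_mat_vec)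
qed

text \<open>Each step is the contraction \<open>exp (\<tau> A)\<close> followed by an explicit Euler
  step for \<open>f\<close>, and both preserve the interval. This keeps the numerical values where
  \<open>F1\<close> is a Lipschitz constant.\<close>

lemma LRI1b_bounded:
  assumes gen: "generator_mat n A" and v: "v \<in> carrier_vec n"
    and C1: "C1_on_interval \<beta> f f'" and f: "f \<beta> \<le> 0" "0 \<le> f (- \<beta>)"
    and \<tau>: "0 < \<tau>" "\<tau> \<le> omega0 \<beta> f'"
    and v_bound: "\<And>i. i < n \<Longrightarrow> \<bar>v $ i\<bar> \<le> \<beta>" and i: "i < n"
  shows "\<bar>LRI1b A f \<tau> v m $ i\<bar> \<le> \<beta>"
  using i
proof (induction m arbitrary: i)
  case (Suc m)
  have A: "A \<in> carrier_mat n n" using gen by (simp add: generator_mat_def)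
  show ?case
    unfolding LRI1b_Suc_index[OF A v Suc.prems refl]
    using Suc \<tau>
    by (intro explicit_euler_invariant[OF C1 f] generator_mat_exp_contraction[OF gen]) auto
qed (simp add: v_bound)

text \<open>One step amplifies the error by at most \<open>1 + \<tau> * F1\<close> and adds a local
  error of at most \<open>K * \<tau>\<^sup>2\<close>; \<open>discrete_gronwall\<close> accumulates
  these.\<close>

lemma LRI1b_global_error:
  assumes gen: "generator_mat n A" and C1: "C1_on_interval \<beta> f f'"
    and f: "f \<beta> \<le> 0" "0 \<le> f (- \<beta>)"
    and F0: "F0 = max_abs \<beta> f" and F1: "F1 = max_abs \<beta> f'" "0 < F1"
    and sol: "solves_ode A f v0 T u" and dim: "dim_vec v0 = n" and n: "0 < n" and \<beta>: "0 < \<beta>"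
    and bound: "\<And>t. 0 \<le> t \<Longrightarrow> t \<le> T \<Longrightarrow> linf_vec (u t) \<le> \<beta>"
    and \<tau>: "0 < \<tau>" "\<tau> \<le> omega0 \<beta> f'" and MT: "real M * \<tau> \<le> T" and m: "m \<le> M"
    and K: "K = linf_mat A * F0 + F1 * (2 * linf_mat A * \<beta> + F0)"
  shows "linf_vec (LRI1b A f \<tau> (u 0) m - u (real m * \<tau>))
    \<le> K / F1 * (exp (F1 * (real m * \<tau>)) - 1) * \<tau>"
proof -
  have A: "A \<in> carrier_mat n n" using gen by (simp add: generator_mat_def)
  \<comment> \<open>Makes time 0 admissible, so that the starting vector inherits the bound on
    \<open>u\<close>.\<close>
  have T: "0 \<le> T" using MT \<tau>(1) by (meson mult_nonneg_nonneg of_nat_0_le_iff order_trans less_imp_le)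
  have tm: "0 \<le> real k * \<tau>" "real k * \<tau> \<le> T" if "k \<le> M" for k
  proof -
    have "real k * \<tau> \<le> real M * \<tau>" using that \<tau>(1) by (intro mult_right_mono) auto
    then show "real k * \<tau> \<le> T" using MT by (rule order_trans)
    show "0 \<le> real k * \<tau>" using \<tau>(1) by simp
  qed
  have carr: "u t \<in> carrier_vec n" if "0 \<le> t" "t \<le> T" for t
    using sol dim that by (auto simp: solves_ode_def)
  have u_bound: "\<bar>u t $ j\<bar> \<le> \<beta>" if "0 \<le> t" "t \<le> T" "j < n" for t j
    using bound[OF that(1,2)] linf_vec_le_iff[OF carr[OF that(1,2)] n] that(3) by blast
  have u0: "u 0 \<in> carrier_vec n" "\<And>j. j < n \<Longrightarrow> \<bar>u 0 $ j\<bar> \<le> \<beta>"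
    using carr u_bound T by auto
  let ?U = "LRI1b A f \<tau> (u 0)"
  let ?e = "\<lambda>k. ?U k - u (real k * \<tau>)"
  have U: "?U k \<in> carrier_vec n" for k by (rule LRI1b_carrier[OF A u0(1)])
  have e: "?e k \<in> carrier_vec n" if "k \<le> M" for k
    using carr[OF tm[OF that]] by (rule minus_carrier_vec[OF U])
  have e_index: "?e k $ j = ?U k $ j - u (real k * \<tau>) $ j" if "k \<le> M" "j < n" for k j
    using carr[OF tm[OF that(1)]] that(2) by simp
  have F00: "0 \<le> F0"
    using max_abs_upper[OF C1_on_interval_continuous[OF C1], of 0] \<beta> F0 by simp
  have K0: "0 \<le> K"
    using linf_mat_nonneg[OF A n] F00 F1(2) \<beta> by (simp add: K)
  have "linf_vec (?e (Suc k)) \<le> (1 + \<tau> * F1) * linf_vec (?e k) + K * \<tau>\<^sup>2" if k: "k < M" for k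
  proof -
    let ?p = "real k * \<tau>"
    have "\<bar>?e (Suc k) $ i\<bar> \<le> (1 + \<tau> * F1) * linf_vec (?e k) + K * \<tau>\<^sup>2" if i: "i < n" for i
    proof -
      \<comment> \<open>\<open>w\<close> and \<open>z\<close> arise by applying the exponential to
        the numerical and to the exact value at the same time, so contraction controls their
        difference by the current error.\<close>
      define w where "w = (\<Sum>j<n. exp_mat (\<tau> \<cdot>\<^sub>m A) $$ (i, j) * ?U k $ j)"
      define z where "z = (\<Sum>j<n. exp_mat (\<tau> \<cdot>\<^sub>m A) $$ (i, j) * u ?p $ j)"
      have "w - z = (\<Sum>j<n. exp_mat (\<tau> \<cdot>\<^sub>m A) $$ (i, j) * ?e k $ j)"
        using k e_index[of k]
        by (auto simp: w_def z_def sum_subtractf[symmetric] right_diff_distrib intro!: sum.cong)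
      moreover have "\<bar>?e k $ j\<bar> \<le> linf_vec (?e k)" if "j < n" for j
        using linf_vec_le_iff[OF e n, of k] k that by auto
      ultimately have wz: "\<bar>w - z\<bar> \<le> linf_vec (?e k)"
        using generator_mat_exp_contraction[OF gen _ i, of \<tau> "\<lambda>j. ?e k $ j"] \<tau>(1) by simp
      have "\<bar>w\<bar> \<le> \<beta>"
        unfolding w_def using \<tau> LRI1b_bounded[OF gen u0(1) C1 f \<tau> u0(2)]
        by (intro generator_mat_exp_contraction[OF gen _ i]) auto
      moreover have "\<bar>z\<bar> \<le> \<beta>"
        unfolding z_def using \<tau> tm[of k] k u_bound
        by (intro generator_mat_exp_contraction[OF gen _ i]) auto
      ultimately have "\<bar>f w - f z\<bar> \<le> F1 * \<bar>w - z\<bar>"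
        unfolding F1 by (rule C1_on_interval_lipschitz[OF C1])
      also have "\<dots> \<le> F1 * linf_vec (?e k)"
        using wz F1(2) by (intro mult_left_mono) auto
      finally have "\<tau> * \<bar>f w - f z\<bar> \<le> \<tau> * (F1 * linf_vec (?e k))"
        using \<tau>(1) by (intro mult_left_mono) auto
      then have fwz: "\<bar>\<tau> * (f w - f z)\<bar> \<le> \<tau> * F1 * linf_vec (?e k)"
        using \<tau>(1) by (simp add: abs_mult)
      have p: "?p + \<tau> = real (Suc k) * \<tau>" by (simp add: algebra_simps)
      then have "?p + \<tau> \<le> T" using tm[of "Suc k"] k by simp
      from LRI1b_local_error[OF gen C1 sol dim u_bound _ \<tau>(1) this i z_def F0 F1(1)]
      have loc: "\<bar>u (real (Suc k) * \<tau>) $ i - (z + \<tau> * f z)\<bar> \<le> K * \<tau>\<^sup>2"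
        using tm[of k] k unfolding p K by simp
      \<comment> \<open>Inserting one step of the scheme started from the exact value splits the new
        error into linear propagation, nonlinear propagation and the local error.\<close>
      have "?e (Suc k) $ i = (w - z) + \<tau> * (f w - f z)
          - (u (real (Suc k) * \<tau>) $ i - (z + \<tau> * f z))"
        using e_index[of "Suc k" i] k i LRI1b_Suc_index[OF A u0(1) i w_def]
        by (simp add: algebra_simps del: LRI1b.simps of_nat_Suc)
      then have "\<bar>?e (Suc k) $ i\<bar> \<le> linf_vec (?e k) + \<tau> * F1 * linf_vec (?e k) + K * \<tau>\<^sup>2"
        using wz fwz loc by linarith
      then show ?thesis by (simp add: distrib_right)
    qed
    then show ?thesis
      using linf_vec_le_iff[OF e n, of "Suc k"] k by (simp del: LRI1b.simps of_nat_Suc)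
  qed
  moreover have "linf_vec (?e 0) \<le> 0"
    using linf_vec_le_iff[OF e n, of 0 0] u0(1) by simp
  ultimately show ?thesis
    by (intro discrete_gronwall[where e = "\<lambda>k. linf_vec (?e k)" and M = M] F1(2) \<tau>(1) K0 m)
qed

theorem theorem6:
  shows "\<exists>C :: real \<Rightarrow> real \<Rightarrow> real \<Rightarrow> real \<Rightarrow> real.
    (\<forall>b p q r. 0 < C b p q r) \<and>
    (\<forall>(T::real) (h::real) (\<epsilon>::real) (\<beta>::real) f f' a b ns u0 u A F0 F1.
       0 < T \<longrightarrow> 0 < \<epsilon> \<longrightarrow> 0 < \<beta> \<longrightarrow>
       uniform_grid h a b ns \<longrightarrow>
       A = \<epsilon>\<^sup>2 \<cdot>\<^sub>m D_h h ns \<longrightarrow>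
       f \<beta> \<le> 0 \<longrightarrow> 0 \<le> f (- \<beta>) \<longrightarrow>
       C1_on_interval \<beta> f f' \<longrightarrow>
       \<not> (\<exists>c. \<forall>x\<in>{-\<beta>..\<beta>}. f x = c) \<longrightarrow>
       F0 = max_abs \<beta> f \<longrightarrow> F1 = max_abs \<beta> f' \<longrightarrow>
       Linf_norm (closed_box a b) u0 \<le> ereal \<beta> \<longrightarrow>
       solves_ode A f (grid_restriction h a ns u0) T u \<longrightarrow>
       (\<forall>t\<in>{0..T}. linf_vec (u t) \<le> \<beta>) \<longrightarrow>
       (\<forall>(M::nat) \<Delta>t t. 0 < M \<longrightarrow> \<Delta>t = T / real M \<longrightarrow> t = (\<lambda>m. real m * \<Delta>t) \<longrightarrow>
          0 < \<Delta>t \<longrightarrow> \<Delta>t \<le> omega0 \<beta> f' \<longrightarrow>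
          (\<forall>m\<in>{0..M}.
             linf_vec (LRI1b A f \<Delta>t (u 0) m - u (t m))
               \<le> C \<beta> F0 F1 (linf_mat A) * (exp (F1 * t m) - 1) * \<Delta>t)))"
  
proof -
  define C :: "real \<Rightarrow> real \<Rightarrow> real \<Rightarrow> real \<Rightarrow> real" where
    \<comment> \<open>The quotient is \<open>K / F1\<close> from the global error bound. The maximum
      with 1 makes \<open>C\<close> positive for all real arguments, also where the quotient is not
      positive.\<close>
    "C b p q r = max 1 ((r * p + q * (2 * r * b + p)) / q)" for b p q r
  have "linf_vec (LRI1b A f \<tau> (u 0) m - u (real m * \<tau>))
      \<le> C \<beta> F0 F1 (linf_mat A) * (exp (F1 * (real m * \<tau>)) - 1) * \<tau>"
    if \<beta>: "0 < \<beta>" and grid: "uniform_grid h a b ns" and A: "A = \<epsilon>\<^sup>2 \<cdot>\<^sub>m D_h h ns"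
      and f: "f \<beta> \<le> 0" "0 \<le> f (- \<beta>)" and C1: "C1_on_interval \<beta> f f'"
      and nonconst: "\<not> (\<exists>c. \<forall>x\<in>{-\<beta>..\<beta>}. f x = c)"
      and F: "F0 = max_abs \<beta> f" "F1 = max_abs \<beta> f'"
      and sol: "solves_ode A f (grid_restriction h a ns u0) T u"
      and bound: "\<forall>t\<in>{0..T}. linf_vec (u t) \<le> \<beta>"
      and M: "0 < M" "\<tau> = T / real M" and \<tau>: "0 < \<tau>" "\<tau> \<le> omega0 \<beta> f'" and m: "m \<le> M"
    for T h \<epsilon> \<beta> f f' a b ns u0 u A F0 F1 and M m :: nat and \<tau>
  proof -
    have len: "length ns \<in> {1, 2, 3}" "\<forall>k<length ns. 2 \<le> ns ! k"
      using grid by (auto simp: uniform_grid_def)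
    have gen: "generator_mat (prod_list ns) A"
      unfolding A by (intro generator_mat_smult generator_mat_D_h len) simp
    \<comment> \<open>A positive number of grid points ensures that the maximum in
      \<open>linf_vec\<close> is taken over a nonempty set.\<close>
    have "0 \<notin> set ns" using len(2) by (force simp: in_set_conv_nth)
    then have n: "0 < prod_list ns" by (metis gr0I prod_list_zero_iff)
    have dim: "dim_vec (grid_restriction h a ns u0) = prod_list ns"
      by (simp add: grid_restriction_def)
    have F1: "0 < F1" unfolding F by (rule C1_on_interval_max_abs_pos[OF C1 nonconst])
    let ?K = "linf_mat A * F0 + F1 * (2 * linf_mat A * \<beta> + F0)"
    let ?x = "exp (F1 * (real m * \<tau>)) - 1"
    have "linf_vec (LRI1b A f \<tau> (u 0) m - u (real m * \<tau>)) \<le> ?K / F1 * ?x * \<tau>"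
      using bound M m by (intro LRI1b_global_error[OF gen C1 f F F1 sol dim n \<beta> _ \<tau> _ m]) auto
    \<comment> \<open>Enlarging the constant is harmless because \<open>?x\<close> and the step size
      are nonnegative.\<close>
    also have "\<dots> \<le> C \<beta> F0 F1 (linf_mat A) * ?x * \<tau>"
      using F1 \<tau>(1) by (intro mult_right_mono) (auto simp: C_def)
    finally show ?thesis .
  qed
  note error = this
  show ?thesis
  proof (rule exI[of _ C], intro conjI allI impI ballI)
    show "0 < C b p q r" for b p q r
      by (simp add: C_def less_max_iff_disj)
  next
    fix T h \<epsilon> \<beta> :: real and f f' :: "real \<Rightarrow> real" and a b :: "real vec" and ns u0 u A F0 F1
      and M :: nat and \<tau> t m
    assume asm: "0 < \<beta>" "uniform_grid h a b ns" "A = \<epsilon>\<^sup>2 \<cdot>\<^sub>m D_h h ns" "f \<beta> \<le> 0" "0 \<le> f (- \<beta>)"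
      "C1_on_interval \<beta> f f'" "\<not> (\<exists>c. \<forall>x\<in>{-\<beta>..\<beta>}. f x = c)"
      "F0 = max_abs \<beta> f" "F1 = max_abs \<beta> f'" "solves_ode A f (grid_restriction h a ns u0) T u"
      "\<forall>t\<in>{0..T}. linf_vec (u t) \<le> \<beta>" "0 < M" "\<tau> = T / real M" "0 < \<tau>" "\<tau> \<le> omega0 \<beta> f'"
      and t: "t = (\<lambda>m. real m * \<tau>)" and m: "m \<in> {0..M}"
    show "linf_vec (LRI1b A f \<tau> (u 0) m - u (t m))
        \<le> C \<beta> F0 F1 (linf_mat A) * (exp (F1 * t m) - 1) * \<tau>"
      unfolding t using m by (intro error[OF asm]) simp
  qed
qed

end
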